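(* Let $\mathcal C$ be a tensor category, $\mathcal D\subseteq\mathcal C$ a tensor subcategory, $\mathcal M$ a left $\mathcal C$-module category, and let $\mathrm{Res}\,\mathcal M$ denote $\mathcal M$ regarded as a left $\mathcal D$-module category by restriction. Let $S:\mathcal M^{op}\times\mathcal M\to\mathcal A$ be a functor equipped with a pre-balancing $\beta^X_{M,N}:S(M,X\triangleright N)\to S(X^*\triangleright M,N)$ ($X\in\mathcal C$). Assume the module (co)ends below exist. (i) There exists a monomorphism in $\mathcal A$ $$\oint_{M\in\mathcal M}(S,\beta)\hookrightarrow\oint_{M\in\mathrm{Res}\,\mathcal M}(S,\beta).$$ (ii) There exists an epimorphism in $\mathcal A$ $$\oint^{M\in\mathrm{Res}\,\mathcal M}(S,\beta)\twoheadrightarrow\oint^{M\in\mathcal M}(S,\beta).$$ On $\mathrm{Res}\,\mathcal M$ the pre-balancing is the restriction of $\beta$ to $X\in\mathcal D$.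
   Context: $k$ is a field; all categories are finite abelian $k$-linear; functors are additive and $k$-linear (in each variable). A tensor category $\mathcal C$ over $k$ is a rigid monoidal category (with $k$-bilinear tensor product) with simple unit $\mathbf 1$. For $X\in\mathcal C$, $X^*$ is the dual with $\mathrm{ev}_X:X^*\otimes X\to\mathbf 1$, $\mathrm{coev}_X:\mathbf 1\to X\otimes X^*$. A left $\mathcal C$-module category is a category $\mathcal M$ with a bifunctor $\triangleright:\mathcal C\times\mathcal M\to\mathcal M$, exact in each variable, and natural isomorphisms $m_{X,Y,M}:(X\otimes Y)\triangleright M\to X\triangleright(Y\triangleright M)$, $\ell_M:\mathbf 1\triangleright M\to M$ satisfying the usual pentagon and triangle axioms (the $\ell$ are suppressed in formulas). A pre-balancing of $S:\mathcal M^{op}\times\mathcal M\to\mathcal A$ is a natural isomorphism $\beta^X_{M,N}:S(M,X\triangleright N)\to S(X^*\triangleright M,N)$. Module end $\oint_{M\in\mathcal M}(S,\beta)$: an object $E\in\mathcal A$ with a dinatural $\pi_M:E\to S(M,M)$ satisfying, for all $X,M$, $S(\mathrm{ev}_X\triangleright\mathrm{id}_M,\mathrm{id}_M)\pi_M=S(m_{X^*,X,M},\mathrm{id}_M)\beta^X_{X\triangleright M,M}\pi_{X\triangleright M}$, and universal: any $\tilde E$ with dinatural $\xi_M:\tilde E\to S(M,M)$ satisfying the same equation factors as $\xi_M=\pi_M\circ h$ for a unique $h:\tilde E\to E$. Module coend $\oint^{M\in\mathcal M}(S,\beta)$: an object $C$ with a dinatural $\pi_M:S(M,M)\to C$ satisfying,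 for all $X,M$, $\pi_M=\pi_{X^*\triangleright M}\beta^X_{M,X^*\triangleright M}S(\mathrm{id}_M,m_{X,X^*,M})S(\mathrm{id}_M,\mathrm{coev}_X\triangleright\mathrm{id}_M)$, and universal (initial) with this property. *)

theory Defs
  imports "Jordan_Normal_Form.Missing_VectorSpace"
begin

section \<open>Linear categories\<close>

text \<open>
  Each hom-set is a module record in the sense of \<^theory>\<open>HOL-Algebra.Module\<close>; the ring multiplication
  and unit fields of that record carry no meaning.  Composition is written in the usual order.
\<close>

record ('o, 'm, 'k) lin_cat =
  Ob :: "'o set"
  Mor :: "'o \<Rightarrow> 'o \<Rightarrow> ('k, 'm) module"
  cmp :: "'m \<Rightarrow> 'm \<Rightarrow> 'm" (infixr \<open>\<bullet>\<index>\<close> 60)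
  ide :: "'o \<Rightarrow> 'm"

abbreviation Hom :: "('o, 'm, 'k, 'z) lin_cat_scheme \<Rightarrow> 'o \<Rightarrow> 'o \<Rightarrow> 'm set"
  where "Hom C A B \<equiv> carrier (Mor C A B)"

locale category =
  fixes C :: "('o, 'm, 'k, 'z) lin_cat_scheme" (structure)
  assumes ide_in: "A \<in> Ob C \<Longrightarrow> ide C A \<in> Hom C A A"
    and cmp_in: "\<lbrakk>A \<in> Ob C; B \<in> Ob C; D \<in> Ob C; f \<in> Hom C A B; g \<in> Hom C B D\<rbrakk>
      \<Longrightarrow> g \<bullet> f \<in> Hom C A D"
    and ide_left: "\<lbrakk>A \<in> Ob C; B \<in> Ob C; f \<in> Hom C A B\<rbrakk> \<Longrightarrow> ide C B \<bullet> f = f"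
    and ide_right: "\<lbrakk>A \<in> Ob C; B \<in> Ob C; f \<in> Hom C A B\<rbrakk> \<Longrightarrow> f \<bullet> ide C A = f"
    and cmp_assoc: "\<lbrakk>A \<in> Ob C; B \<in> Ob C; D \<in> Ob C; E \<in> Ob C;
        f \<in> Hom C A B; g \<in> Hom C B D; h \<in> Hom C D E\<rbrakk>
      \<Longrightarrow> (h \<bullet> g) \<bullet> f = h \<bullet> (g \<bullet> f)"
    and Hom_disjoint: "\<lbrakk>A \<in> Ob C; B \<in> Ob C; A' \<in> Ob C; B' \<in> Ob C;
        f \<in> Hom C A B; f \<in> Hom C A' B'\<rbrakk> \<Longrightarrow> A = A' \<and> B = B'"

locale linear_category = field K + category C
  for K :: "('k, 'r) ring_scheme" and C :: "('o, 'm, 'k, 'z) lin_cat_scheme" (structure) +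
  assumes vectorspace_Mor: "\<lbrakk>A \<in> Ob C; B \<in> Ob C\<rbrakk> \<Longrightarrow> vectorspace K (Mor C A B)"
    and cmp_linear_right: "\<lbrakk>A \<in> Ob C; B \<in> Ob C; D \<in> Ob C; g \<in> Hom C B D\<rbrakk>
      \<Longrightarrow> linear_map K (Mor C A B) (Mor C A D) (\<lambda>f. g \<bullet> f)"
    and cmp_linear_left: "\<lbrakk>A \<in> Ob C; B \<in> Ob C; D \<in> Ob C; f \<in> Hom C A B\<rbrakk>
      \<Longrightarrow> linear_map K (Mor C B D) (Mor C A D) (\<lambda>g. g \<bullet> f)"

definition op_cat :: "('o, 'm, 'k, 'z) lin_cat_scheme \<Rightarrow> ('o, 'm, 'k) lin_cat"
  where "op_cat C = \<lparr>Ob = Ob C, Mor = (\<lambda>A B. Mor C B A), cmp = (\<lambda>g f. f \<bullet>\<^bsub>C\<^esub> g), ide = ide C\<rparr>"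

definition is_monic where
  "is_monic C A B f \<longleftrightarrow> A \<in> Ob C \<and> B \<in> Ob C \<and> f \<in> Hom C A B \<and>
    (\<forall>X\<in>Ob C. \<forall>g\<in>Hom C X A. \<forall>h\<in>Hom C X A. f \<bullet>\<^bsub>C\<^esub> g = f \<bullet>\<^bsub>C\<^esub> h \<longrightarrow> g = h)"

definition is_epic where
  "is_epic C A B f \<longleftrightarrow> A \<in> Ob C \<and> B \<in> Ob C \<and> f \<in> Hom C A B \<and>
    (\<forall>X\<in>Ob C. \<forall>g\<in>Hom C B X. \<forall>h\<in>Hom C B X. g \<bullet>\<^bsub>C\<^esub> f = h \<bullet>\<^bsub>C\<^esub> f \<longrightarrow> g = h)"

definition inverse_arrows where
  "inverse_arrows C A B f g \<longleftrightarrow> f \<in> Hom C A B \<and> g \<in> Hom C B A \<and>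
    g \<bullet>\<^bsub>C\<^esub> f = ide C A \<and> f \<bullet>\<^bsub>C\<^esub> g = ide C B"

definition is_isom where
  "is_isom C A B f \<longleftrightarrow> A \<in> Ob C \<and> B \<in> Ob C \<and> (\<exists>g. inverse_arrows C A B f g)"

definition arrow_inv where
  "arrow_inv C A B f = (THE g. inverse_arrows C A B f g)"

definition is_zero_object where
  "is_zero_object C Z \<longleftrightarrow> Z \<in> Ob C \<and>
    (\<forall>A\<in>Ob C. (\<exists>!f. f \<in> Hom C Z A) \<and> (\<exists>!f. f \<in> Hom C A Z))"

definition is_biproduct where
  "is_biproduct C A B P p q i j \<longleftrightarrow> P \<in> Ob C \<and>
    p \<in> Hom C P A \<and> q \<in> Hom C P B \<and> i \<in> Hom C A P \<and> j \<in> Hom C B P \<and>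
    p \<bullet>\<^bsub>C\<^esub> i = ide C A \<and> q \<bullet>\<^bsub>C\<^esub> j = ide C B \<and>
    p \<bullet>\<^bsub>C\<^esub> j = \<zero>\<^bsub>Mor C B A\<^esub> \<and> q \<bullet>\<^bsub>C\<^esub> i = \<zero>\<^bsub>Mor C A B\<^esub> \<and>
    (i \<bullet>\<^bsub>C\<^esub> p) \<oplus>\<^bsub>Mor C P P\<^esub> (j \<bullet>\<^bsub>C\<^esub> q) = ide C P"

definition is_kernel where
  "is_kernel C A B f N k \<longleftrightarrow> N \<in> Ob C \<and> k \<in> Hom C N A \<and> f \<bullet>\<^bsub>C\<^esub> k = \<zero>\<^bsub>Mor C N B\<^esub> \<and>
    (\<forall>X\<in>Ob C. \<forall>h\<in>Hom C X A. f \<bullet>\<^bsub>C\<^esub> h = \<zero>\<^bsub>Mor C X B\<^esub> \<longrightarrow>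
      (\<exists>!u. u \<in> Hom C X N \<and> k \<bullet>\<^bsub>C\<^esub> u = h))"

definition is_cokernel where
  "is_cokernel C A B f Q c \<longleftrightarrow> Q \<in> Ob C \<and> c \<in> Hom C B Q \<and> c \<bullet>\<^bsub>C\<^esub> f = \<zero>\<^bsub>Mor C A Q\<^esub> \<and>
    (\<forall>X\<in>Ob C. \<forall>h\<in>Hom C B X. h \<bullet>\<^bsub>C\<^esub> f = \<zero>\<^bsub>Mor C A X\<^esub> \<longrightarrow>
      (\<exists>!u. u \<in> Hom C Q X \<and> u \<bullet>\<^bsub>C\<^esub> c = h))"

definition short_exact where
  "short_exact C X Y Z f g \<longleftrightarrow> X \<in> Ob C \<and> Y \<in> Ob C \<and> Z \<in> Ob C \<and>
    f \<in> Hom C X Y \<and> g \<in> Hom C Y Z \<and> is_kernel C Y Z g X f \<and> is_cokernel C X Y f Z g"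

definition is_simple where
  "is_simple C X \<longleftrightarrow> X \<in> Ob C \<and> \<not> is_zero_object C X \<and>
    (\<forall>Y\<in>Ob C. \<forall>f. is_monic C Y X f \<longrightarrow> is_zero_object C Y \<or> is_isom C Y X f)"

inductive finite_length :: "('o, 'm, 'k, 'z) lin_cat_scheme \<Rightarrow> 'o \<Rightarrow> bool" for C where
  "is_zero_object C Z \<Longrightarrow> finite_length C Z"
| "\<lbrakk>finite_length C X; is_simple C Z; short_exact C X Y Z f g\<rbrakk> \<Longrightarrow> finite_length C Y"

definition is_projective where
  "is_projective C P \<longleftrightarrow> P \<in> Ob C \<and>
    (\<forall>A B e. is_epic C A B e \<longrightarrow> (\<forall>f\<in>Hom C P B. \<exists>h\<in>Hom C P A. e \<bullet>\<^bsub>C\<^esub> h = f))"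

locale abelian_category = linear_category K C
  for K :: "('k, 'r) ring_scheme" and C :: "('o, 'm, 'k, 'z) lin_cat_scheme" (structure) +
  assumes ex_zero_object: "\<exists>Z. is_zero_object C Z"
    and ex_biproduct: "\<lbrakk>A \<in> Ob C; B \<in> Ob C\<rbrakk> \<Longrightarrow> \<exists>P p q i j. is_biproduct C A B P p q i j"
    and ex_kernel: "\<lbrakk>A \<in> Ob C; B \<in> Ob C; f \<in> Hom C A B\<rbrakk> \<Longrightarrow> \<exists>N k. is_kernel C A B f N k"
    and ex_cokernel: "\<lbrakk>A \<in> Ob C; B \<in> Ob C; f \<in> Hom C A B\<rbrakk> \<Longrightarrow> \<exists>Q c. is_cokernel C A B f Q c"
    and monic_is_kernel: "is_monic C A B f \<Longrightarrow> \<exists>D\<in>Ob C. \<exists>g\<in>Hom C B D. is_kernel C B D g A f"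
    and epic_is_cokernel: "is_epic C A B f \<Longrightarrow> \<exists>D\<in>Ob C. \<exists>g\<in>Hom C D A. is_cokernel C D A g B f"

text \<open>
  Finiteness is the intrinsic form of being equivalent to the finite-dimensional modules over a
  finite-dimensional algebra (Etingof--Gelaki--Nikshych--Ostrik, Tensor Categories).
\<close>

locale finite_abelian_category = abelian_category K C
  for K :: "('k, 'r) ring_scheme" and C :: "('o, 'm, 'k, 'z) lin_cat_scheme" (structure) +
  assumes fin_dim_Mor: "\<lbrakk>A \<in> Ob C; B \<in> Ob C\<rbrakk> \<Longrightarrow> vectorspace.fin_dim K (Mor C A B)"
    and all_finite_length: "X \<in> Ob C \<Longrightarrow> finite_length C X"
    and enough_projectives: "X \<in> Ob C \<Longrightarrow> \<exists>P e. is_projective C P \<and> is_epic C P X e"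
    and finitely_many_simples:
      "\<exists>F. finite F \<and> F \<subseteq> Ob C \<and> (\<forall>X. is_simple C X \<longrightarrow> (\<exists>Y\<in>F. \<exists>f. is_isom C X Y f))"

locale linear_functor = dom: linear_category K C + cod: linear_category K D
  for K :: "('k, 'r) ring_scheme"
    and C :: "('o, 'm, 'k, 'z) lin_cat_scheme" and D :: "('p, 'n, 'k, 'y) lin_cat_scheme" +
  fixes Fo :: "'o \<Rightarrow> 'p" and Fm :: "'m \<Rightarrow> 'n"
  assumes Fo_in: "A \<in> Ob C \<Longrightarrow> Fo A \<in> Ob D"
    and Fm_linear: "\<lbrakk>A \<in> Ob C; B \<in> Ob C\<rbrakk>
      \<Longrightarrow> linear_map K (Mor C A B) (Mor D (Fo A) (Fo B)) Fm"
    and Fm_ide: "A \<in> Ob C \<Longrightarrow> Fm (ide C A) = ide D (Fo A)"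
    and Fm_cmp: "\<lbrakk>A \<in> Ob C; B \<in> Ob C; E \<in> Ob C; f \<in> Hom C A B; g \<in> Hom C B E\<rbrakk>
      \<Longrightarrow> Fm (g \<bullet>\<^bsub>C\<^esub> f) = Fm g \<bullet>\<^bsub>D\<^esub> Fm f"

locale exact_functor = linear_functor K C D Fo Fm
  for K :: "('k, 'r) ring_scheme"
    and C :: "('o, 'm, 'k, 'z) lin_cat_scheme" and D :: "('p, 'n, 'k, 'y) lin_cat_scheme"
    and Fo Fm +
  assumes preserves_short_exact:
    "short_exact C X Y Z f g \<Longrightarrow> short_exact D (Fo X) (Fo Y) (Fo Z) (Fm f) (Fm g)"

record ('o, 'm, 'p, 'n, 'q, 'l) bifunctor =
  bobj :: "'o \<Rightarrow> 'p \<Rightarrow> 'q"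
  bmor :: "'m \<Rightarrow> 'n \<Rightarrow> 'l"

locale linear_bifunctor = L: linear_category K B + R: linear_category K C + T: linear_category K D
  for K :: "('k, 'r) ring_scheme"
    and B :: "('o, 'm, 'k, 'x) lin_cat_scheme"
    and C :: "('p, 'n, 'k, 'y) lin_cat_scheme"
    and D :: "('q, 'l, 'k, 'z) lin_cat_scheme" +
  fixes F :: "('o, 'm, 'p, 'n, 'q, 'l) bifunctor"
  assumes bobj_in: "\<lbrakk>X \<in> Ob B; Y \<in> Ob C\<rbrakk> \<Longrightarrow> bobj F X Y \<in> Ob D"
    and bmor_linear_left: "\<lbrakk>X \<in> Ob B; X' \<in> Ob B; Y \<in> Ob C; Y' \<in> Ob C; g \<in> Hom C Y Y'\<rbrakk>
      \<Longrightarrow> linear_map K (Mor B X X') (Mor D (bobj F X Y) (bobj F X' Y')) (\<lambda>f. bmor F f g)"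
    and bmor_linear_right: "\<lbrakk>X \<in> Ob B; X' \<in> Ob B; Y \<in> Ob C; Y' \<in> Ob C; f \<in> Hom B X X'\<rbrakk>
      \<Longrightarrow> linear_map K (Mor C Y Y') (Mor D (bobj F X Y) (bobj F X' Y')) (\<lambda>g. bmor F f g)"
    and bmor_ide: "\<lbrakk>X \<in> Ob B; Y \<in> Ob C\<rbrakk> \<Longrightarrow> bmor F (ide B X) (ide C Y) = ide D (bobj F X Y)"
    and bmor_cmp: "\<lbrakk>X \<in> Ob B; X' \<in> Ob B; X'' \<in> Ob B; Y \<in> Ob C; Y' \<in> Ob C; Y'' \<in> Ob C;
        f \<in> Hom B X X'; f' \<in> Hom B X' X''; g \<in> Hom C Y Y'; g' \<in> Hom C Y' Y''\<rbrakk>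
      \<Longrightarrow> bmor F (f' \<bullet>\<^bsub>B\<^esub> f) (g' \<bullet>\<^bsub>C\<^esub> g) = bmor F f' g' \<bullet>\<^bsub>D\<^esub> bmor F f g"


section \<open>Tensor categories\<close>

text \<open>
  The record contains a choice of left dual, evaluation and coevaluation for every object.
\<close>

record ('o, 'm, 'k) tens_cat = "('o, 'm, 'k) lin_cat" +
  tens :: "('o, 'm, 'o, 'm, 'o, 'm) bifunctor"
  unitob :: "'o"
  asc :: "'o \<Rightarrow> 'o \<Rightarrow> 'o \<Rightarrow> 'm"
  lunit :: "'o \<Rightarrow> 'm"
  runit :: "'o \<Rightarrow> 'm"
  dual :: "'o \<Rightarrow> 'o"
  ev :: "'o \<Rightarrow> 'm"
  coev :: "'o \<Rightarrow> 'm"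

abbreviation tens_ob (infixr \<open>\<otimes>\<^sub>o\<index>\<close> 70)
  where "X \<otimes>\<^sub>o\<^bsub>C\<^esub> Y \<equiv> bobj (tens C) X Y"

abbreviation tens_mor (infixr \<open>\<otimes>\<^sub>m\<index>\<close> 70)
  where "f \<otimes>\<^sub>m\<^bsub>C\<^esub> g \<equiv> bmor (tens C) f g"

locale monoidal_category = linear_bifunctor K C C C "tens C"
  for K :: "('k, 'r) ring_scheme" and C :: "('o, 'm, 'k, 'z) tens_cat_scheme" (structure) +
  assumes unitob_in: "unitob C \<in> Ob C"
    and asc_isom: "\<lbrakk>X \<in> Ob C; Y \<in> Ob C; Z \<in> Ob C\<rbrakk>
      \<Longrightarrow> is_isom C ((X \<otimes>\<^sub>o Y) \<otimes>\<^sub>o Z) (X \<otimes>\<^sub>o (Y \<otimes>\<^sub>o Z)) (asc C X Y Z)"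
    and lunit_isom: "X \<in> Ob C \<Longrightarrow> is_isom C (unitob C \<otimes>\<^sub>o X) X (lunit C X)"
    and runit_isom: "X \<in> Ob C \<Longrightarrow> is_isom C (X \<otimes>\<^sub>o unitob C) X (runit C X)"
    and asc_natural: "\<lbrakk>X \<in> Ob C; Y \<in> Ob C; Z \<in> Ob C; X' \<in> Ob C; Y' \<in> Ob C; Z' \<in> Ob C;
        f \<in> Hom C X X'; g \<in> Hom C Y Y'; h \<in> Hom C Z Z'\<rbrakk>
      \<Longrightarrow> asc C X' Y' Z' \<bullet> ((f \<otimes>\<^sub>m g) \<otimes>\<^sub>m h) = (f \<otimes>\<^sub>m (g \<otimes>\<^sub>m h)) \<bullet> asc C X Y Z"
    and lunit_natural: "\<lbrakk>X \<in> Ob C; X' \<in> Ob C; f \<in> Hom C X X'\<rbrakk>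
      \<Longrightarrow> lunit C X' \<bullet> (ide C (unitob C) \<otimes>\<^sub>m f) = f \<bullet> lunit C X"
    and runit_natural: "\<lbrakk>X \<in> Ob C; X' \<in> Ob C; f \<in> Hom C X X'\<rbrakk>
      \<Longrightarrow> runit C X' \<bullet> (f \<otimes>\<^sub>m ide C (unitob C)) = f \<bullet> runit C X"
    and pentagon: "\<lbrakk>W \<in> Ob C; X \<in> Ob C; Y \<in> Ob C; Z \<in> Ob C\<rbrakk>
      \<Longrightarrow> asc C W X (Y \<otimes>\<^sub>o Z) \<bullet> asc C (W \<otimes>\<^sub>o X) Y Z =
          (ide C W \<otimes>\<^sub>m asc C X Y Z) \<bullet> asc C W (X \<otimes>\<^sub>o Y) Z \<bullet> (asc C W X Y \<otimes>\<^sub>m ide C Z)"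
    and triangle: "\<lbrakk>X \<in> Ob C; Y \<in> Ob C\<rbrakk>
      \<Longrightarrow> (ide C X \<otimes>\<^sub>m lunit C Y) \<bullet> asc C X (unitob C) Y = runit C X \<otimes>\<^sub>m ide C Y"

text \<open>
  \<open>X'\<close> is a left dual of \<open>X\<close>, with evaluation \<open>e : X' \<otimes> X \<rightarrow> 1\<close> and coevaluation
  \<open>c : 1 \<rightarrow> X \<otimes> X'\<close>; equivalently, \<open>X\<close> is a right dual of \<open>X'\<close>.
\<close>

definition is_left_dual where
  "is_left_dual C X X' e c \<longleftrightarrow> X \<in> Ob C \<and> X' \<in> Ob C \<and>
    e \<in> Hom C (X' \<otimes>\<^sub>o\<^bsub>C\<^esub> X) (unitob C) \<and> c \<in> Hom C (unitob C) (X \<otimes>\<^sub>o\<^bsub>C\<^esub> X') \<and>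
    runit C X \<bullet>\<^bsub>C\<^esub> (ide C X \<otimes>\<^sub>m\<^bsub>C\<^esub> e) \<bullet>\<^bsub>C\<^esub> asc C X X' X \<bullet>\<^bsub>C\<^esub> (c \<otimes>\<^sub>m\<^bsub>C\<^esub> ide C X)
      \<bullet>\<^bsub>C\<^esub> arrow_inv C (unitob C \<otimes>\<^sub>o\<^bsub>C\<^esub> X) X (lunit C X) = ide C X \<and>
    lunit C X' \<bullet>\<^bsub>C\<^esub> (e \<otimes>\<^sub>m\<^bsub>C\<^esub> ide C X')
      \<bullet>\<^bsub>C\<^esub> arrow_inv C ((X' \<otimes>\<^sub>o\<^bsub>C\<^esub> X) \<otimes>\<^sub>o\<^bsub>C\<^esub> X') (X' \<otimes>\<^sub>o\<^bsub>C\<^esub> (X \<otimes>\<^sub>o\<^bsub>C\<^esub> X')) (asc C X' X X')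
      \<bullet>\<^bsub>C\<^esub> (ide C X' \<otimes>\<^sub>m\<^bsub>C\<^esub> c)
      \<bullet>\<^bsub>C\<^esub> arrow_inv C (X' \<otimes>\<^sub>o\<^bsub>C\<^esub> unitob C) X' (runit C X') = ide C X'"

locale tensor_category = finite_abelian_category K C + monoidal_category K C
  for K :: "('k, 'r) ring_scheme" and C :: "('o, 'm, 'k, 'z) tens_cat_scheme" (structure) +
  assumes unitob_simple: "is_simple C (unitob C)"
    and left_dual: "X \<in> Ob C \<Longrightarrow> is_left_dual C X (dual C X) (ev C X) (coev C X)"
    and right_dual: "X \<in> Ob C \<Longrightarrow> \<exists>Y e c. is_left_dual C Y X e c"

text \<open>For \<open>f : X \<rightarrow> Y\<close>, the transposed morphism \<open>Y\<^sup>* \<rightarrow> X\<^sup>*\<close>.\<close>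

definition dual_mor where
  "dual_mor C X Y f =
    lunit C (dual C X) \<bullet>\<^bsub>C\<^esub> (ev C Y \<otimes>\<^sub>m\<^bsub>C\<^esub> ide C (dual C X))
      \<bullet>\<^bsub>C\<^esub> arrow_inv C ((dual C Y \<otimes>\<^sub>o\<^bsub>C\<^esub> Y) \<otimes>\<^sub>o\<^bsub>C\<^esub> dual C X) (dual C Y \<otimes>\<^sub>o\<^bsub>C\<^esub> (Y \<otimes>\<^sub>o\<^bsub>C\<^esub> dual C X))
          (asc C (dual C Y) Y (dual C X))
      \<bullet>\<^bsub>C\<^esub> (ide C (dual C Y) \<otimes>\<^sub>m\<^bsub>C\<^esub> (f \<otimes>\<^sub>m\<^bsub>C\<^esub> ide C (dual C X)))
      \<bullet>\<^bsub>C\<^esub> (ide C (dual C Y) \<otimes>\<^sub>m\<^bsub>C\<^esub> coev C X)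
      \<bullet>\<^bsub>C\<^esub> arrow_inv C (dual C Y \<otimes>\<^sub>o\<^bsub>C\<^esub> unitob C) (dual C Y) (runit C (dual C Y))"

text \<open>
  \<open>D\<close> is a tensor category whose objects, morphisms and structure are inherited from \<open>C\<close>, and the
  inclusion is linear and exact (exactness is what makes restriction of a module category along it
  again exact in the first variable).  Fullness is not required.  The chosen duals of \<open>D\<close> are those
  of \<open>C\<close>, so that \<open>X\<^sup>*\<close> is unambiguous for \<open>X \<in> D\<close>.
\<close>

locale tensor_subcategory =
  big: tensor_category K C + sub: tensor_category K D + incl: exact_functor K D C "\<lambda>X. X" "\<lambda>f. f"
  for K :: "('k, 'r) ring_scheme"
    and D :: "('o, 'm, 'k, 'y) tens_cat_scheme" and C :: "('o, 'm, 'k, 'z) tens_cat_scheme" +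
  assumes tens_ob_eq: "\<lbrakk>X \<in> Ob D; Y \<in> Ob D\<rbrakk> \<Longrightarrow> X \<otimes>\<^sub>o\<^bsub>D\<^esub> Y = X \<otimes>\<^sub>o\<^bsub>C\<^esub> Y"
    and tens_mor_eq: "\<lbrakk>X \<in> Ob D; X' \<in> Ob D; Y \<in> Ob D; Y' \<in> Ob D; f \<in> Hom D X X'; g \<in> Hom D Y Y'\<rbrakk>
      \<Longrightarrow> f \<otimes>\<^sub>m\<^bsub>D\<^esub> g = f \<otimes>\<^sub>m\<^bsub>C\<^esub> g"
    and unitob_eq: "unitob D = unitob C"
    and asc_eq: "\<lbrakk>X \<in> Ob D; Y \<in> Ob D; Z \<in> Ob D\<rbrakk> \<Longrightarrow> asc D X Y Z = asc C X Y Z"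
    and lunit_eq: "X \<in> Ob D \<Longrightarrow> lunit D X = lunit C X"
    and runit_eq: "X \<in> Ob D \<Longrightarrow> runit D X = runit C X"
    and dual_eq: "X \<in> Ob D \<Longrightarrow> dual D X = dual C X"
    and ev_eq: "X \<in> Ob D \<Longrightarrow> ev D X = ev C X"
    and coev_eq: "X \<in> Ob D \<Longrightarrow> coev D X = coev C X"


section \<open>Module categories\<close>

text \<open>In \<open>('o, 'm, 'p, 'n, 'k) mod_cat\<close> the acting category has objects \<open>'o\<close> and morphisms \<open>'m\<close>.\<close>

record ('o, 'm, 'p, 'n, 'k) mod_cat = "('p, 'n, 'k) lin_cat" +
  act :: "('o, 'm, 'p, 'n, 'p, 'n) bifunctor"
  masc :: "'o \<Rightarrow> 'o \<Rightarrow> 'p \<Rightarrow> 'n"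
  munit :: "'p \<Rightarrow> 'n"

abbreviation act_ob (infixr \<open>\<rhd>\<^sub>o\<index>\<close> 70)
  where "X \<rhd>\<^sub>o\<^bsub>M\<^esub> N \<equiv> bobj (act M) X N"

abbreviation act_mor (infixr \<open>\<rhd>\<^sub>m\<index>\<close> 70)
  where "f \<rhd>\<^sub>m\<^bsub>M\<^esub> g \<equiv> bmor (act M) f g"

locale module_category =
  acting: tensor_category K C + finite_abelian_category K M + linear_bifunctor K C M M "act M"
  for K :: "('k, 'r) ring_scheme"
    and C :: "('o, 'm, 'k, 'z) tens_cat_scheme"
    and M :: "('o, 'm, 'p, 'n, 'k, 'y) mod_cat_scheme" (structure) +
  assumes exact_right: "X \<in> Ob C \<Longrightarrow> exact_functor K M M (\<lambda>N. X \<rhd>\<^sub>o N) (\<lambda>g. ide C X \<rhd>\<^sub>m g)"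
    and exact_left: "N \<in> Ob M \<Longrightarrow> exact_functor K C M (\<lambda>X. X \<rhd>\<^sub>o N) (\<lambda>f. f \<rhd>\<^sub>m ide M N)"
    and masc_isom: "\<lbrakk>X \<in> Ob C; Y \<in> Ob C; N \<in> Ob M\<rbrakk>
      \<Longrightarrow> is_isom M ((X \<otimes>\<^sub>o\<^bsub>C\<^esub> Y) \<rhd>\<^sub>o N) (X \<rhd>\<^sub>o (Y \<rhd>\<^sub>o N)) (masc M X Y N)"
    and munit_isom: "N \<in> Ob M \<Longrightarrow> is_isom M (unitob C \<rhd>\<^sub>o N) N (munit M N)"
    and masc_natural: "\<lbrakk>X \<in> Ob C; X' \<in> Ob C; Y \<in> Ob C; Y' \<in> Ob C; N \<in> Ob M; N' \<in> Ob M;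
        f \<in> Hom C X X'; g \<in> Hom C Y Y'; h \<in> Hom M N N'\<rbrakk>
      \<Longrightarrow> masc M X' Y' N' \<bullet> ((f \<otimes>\<^sub>m\<^bsub>C\<^esub> g) \<rhd>\<^sub>m h) = (f \<rhd>\<^sub>m (g \<rhd>\<^sub>m h)) \<bullet> masc M X Y N"
    and munit_natural: "\<lbrakk>N \<in> Ob M; N' \<in> Ob M; h \<in> Hom M N N'\<rbrakk>
      \<Longrightarrow> munit M N' \<bullet> (ide C (unitob C) \<rhd>\<^sub>m h) = h \<bullet> munit M N"
    and mpentagon: "\<lbrakk>X \<in> Ob C; Y \<in> Ob C; Z \<in> Ob C; N \<in> Ob M\<rbrakk>
      \<Longrightarrow> masc M X Y (Z \<rhd>\<^sub>o N) \<bullet> masc M (X \<otimes>\<^sub>o\<^bsub>C\<^esub> Y) Z N =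
          (ide C X \<rhd>\<^sub>m masc M Y Z N) \<bullet> masc M X (Y \<otimes>\<^sub>o\<^bsub>C\<^esub> Z) N \<bullet> (asc C X Y Z \<rhd>\<^sub>m ide M N)"
    and mtriangle: "\<lbrakk>X \<in> Ob C; N \<in> Ob M\<rbrakk>
      \<Longrightarrow> (ide C X \<rhd>\<^sub>m munit M N) \<bullet> masc M X (unitob C) N = runit C X \<rhd>\<^sub>m ide M N"


section \<open>Pre-balancings, module ends and module coends\<close>

text \<open>
  In \<^term>\<open>bmor S f g\<close> the first argument is a morphism of the opposite category: for
  \<open>f : M' \<rightarrow> M\<close> and \<open>g : N \<rightarrow> N'\<close> in the module category it is a morphism \<open>S(M,N) \<rightarrow> S(M',N')\<close>.
\<close>

locale pre_balancing =
  module_category K C \<M> + \<A>: finite_abelian_category K \<A> + S: linear_bifunctor K "op_cat \<M>" \<M> \<A> S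
  for K :: "('k, 'r) ring_scheme"
    and C :: "('o, 'm, 'k, 'z) tens_cat_scheme"
    and \<M> :: "('o, 'm, 'p, 'n, 'k, 'y) mod_cat_scheme"
    and \<A> :: "('q, 'l, 'k, 'x) lin_cat_scheme"
    and S :: "('p, 'n, 'p, 'n, 'q, 'l) bifunctor" +
  fixes \<beta> :: "'o \<Rightarrow> 'p \<Rightarrow> 'p \<Rightarrow> 'l"
  assumes \<beta>_isom: "\<lbrakk>X \<in> Ob C; M \<in> Ob \<M>; N \<in> Ob \<M>\<rbrakk>
      \<Longrightarrow> is_isom \<A> (bobj S M (X \<rhd>\<^sub>o\<^bsub>\<M>\<^esub> N)) (bobj S (dual C X \<rhd>\<^sub>o\<^bsub>\<M>\<^esub> M) N) (\<beta> X M N)"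
    and \<beta>_natural: "\<lbrakk>X \<in> Ob C; X' \<in> Ob C; M \<in> Ob \<M>; M' \<in> Ob \<M>; N \<in> Ob \<M>; N' \<in> Ob \<M>;
        f \<in> Hom C X X'; g \<in> Hom \<M> M' M; h \<in> Hom \<M> N N'\<rbrakk>
      \<Longrightarrow> \<beta> X' M' N' \<bullet>\<^bsub>\<A>\<^esub> bmor S g (f \<rhd>\<^sub>m\<^bsub>\<M>\<^esub> h) =
          bmor S (dual_mor C X X' f \<rhd>\<^sub>m\<^bsub>\<M>\<^esub> g) h \<bullet>\<^bsub>\<A>\<^esub> \<beta> X M N"

definition dinatural_from where
  "dinatural_from \<M> \<A> S E \<pi> \<longleftrightarrow> E \<in> Ob \<A> \<and>
    (\<forall>M\<in>Ob \<M>. \<pi> M \<in> Hom \<A> E (bobj S M M)) \<and>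
    (\<forall>M\<in>Ob \<M>. \<forall>N\<in>Ob \<M>. \<forall>f\<in>Hom \<M> M N.
      bmor S (ide \<M> M) f \<bullet>\<^bsub>\<A>\<^esub> \<pi> M = bmor S f (ide \<M> N) \<bullet>\<^bsub>\<A>\<^esub> \<pi> N)"

definition dinatural_to where
  "dinatural_to \<M> \<A> S E \<pi> \<longleftrightarrow> E \<in> Ob \<A> \<and>
    (\<forall>M\<in>Ob \<M>. \<pi> M \<in> Hom \<A> (bobj S M M) E) \<and>
    (\<forall>M\<in>Ob \<M>. \<forall>N\<in>Ob \<M>. \<forall>f\<in>Hom \<M> M N.
      \<pi> M \<bullet>\<^bsub>\<A>\<^esub> bmor S f (ide \<M> M) = \<pi> N \<bullet>\<^bsub>\<A>\<^esub> bmor S (ide \<M> N) f)"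

text \<open>
  The unit constraint \<open>munit\<close> is inserted where it is customarily suppressed: \<open>ev_X \<rhd> id_M\<close> is
  postcomposed with \<open>1 \<rhd> M \<rightarrow> M\<close>, and \<open>coev_X \<rhd> id_M\<close> is precomposed with its inverse.
\<close>

definition end_cone where
  "end_cone C \<M> \<A> S \<beta> E \<pi> \<longleftrightarrow> dinatural_from \<M> \<A> S E \<pi> \<and>
    (\<forall>X\<in>Ob C. \<forall>M\<in>Ob \<M>.
      bmor S (munit \<M> M \<bullet>\<^bsub>\<M>\<^esub> (ev C X \<rhd>\<^sub>m\<^bsub>\<M>\<^esub> ide \<M> M)) (ide \<M> M) \<bullet>\<^bsub>\<A>\<^esub> \<pi> M =
      bmor S (masc \<M> (dual C X) X M) (ide \<M> M) \<bullet>\<^bsub>\<A>\<^esub> \<beta> X (X \<rhd>\<^sub>o\<^bsub>\<M>\<^esub> M) M \<bullet>\<^bsub>\<A>\<^esub> \<pi> (X \<rhd>\<^sub>o\<^bsub>\<M>\<^esub> M))"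

definition is_module_end where
  "is_module_end C \<M> \<A> S \<beta> E \<pi> \<longleftrightarrow> end_cone C \<M> \<A> S \<beta> E \<pi> \<and>
    (\<forall>E' \<xi>. end_cone C \<M> \<A> S \<beta> E' \<xi> \<longrightarrow>
      (\<exists>!h. h \<in> Hom \<A> E' E \<and> (\<forall>M\<in>Ob \<M>. \<xi> M = \<pi> M \<bullet>\<^bsub>\<A>\<^esub> h)))"

definition coend_cocone where
  "coend_cocone C \<M> \<A> S \<beta> E \<pi> \<longleftrightarrow> dinatural_to \<M> \<A> S E \<pi> \<and>
    (\<forall>X\<in>Ob C. \<forall>M\<in>Ob \<M>.
      \<pi> M = \<pi> (dual C X \<rhd>\<^sub>o\<^bsub>\<M>\<^esub> M) \<bullet>\<^bsub>\<A>\<^esub> \<beta> X M (dual C X \<rhd>\<^sub>o\<^bsub>\<M>\<^esub> M)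
        \<bullet>\<^bsub>\<A>\<^esub> bmor S (ide \<M> M) (masc \<M> X (dual C X) M)
        \<bullet>\<^bsub>\<A>\<^esub> bmor S (ide \<M> M)
            ((coev C X \<rhd>\<^sub>m\<^bsub>\<M>\<^esub> ide \<M> M) \<bullet>\<^bsub>\<M>\<^esub> arrow_inv \<M> (unitob C \<rhd>\<^sub>o\<^bsub>\<M>\<^esub> M) M (munit \<M> M)))"

definition is_module_coend where
  "is_module_coend C \<M> \<A> S \<beta> E \<pi> \<longleftrightarrow> coend_cocone C \<M> \<A> S \<beta> E \<pi> \<and>
    (\<forall>E' \<xi>. coend_cocone C \<M> \<A> S \<beta> E' \<xi> \<longrightarrow>
      (\<exists>!h. h \<in> Hom \<A> E E' \<and> (\<forall>M\<in>Ob \<M>. \<xi> M = h \<bullet>\<^bsub>\<A>\<^esub> \<pi> M)))"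



section \<open>Restriction to a tensor subcategory\<close>

text \<open>
  A module category carries its action as functions on the objects and morphisms of the acting
  category, so for a tensor subcategory \<open>D\<close> of \<open>C\<close> the restriction of a \<open>C\<close>-module category \<open>\<M>\<close>
  is the record \<open>\<M>\<close> itself, regarded as a \<open>D\<close>-module category, and a pre-balancing \<open>\<beta>\<close> is
  restricted by only using \<open>\<beta> X\<close> for \<open>X \<in> Ob D\<close>.  The lemmas below justify this; thus
  \<open>is_module_end D \<M> \<A> S \<beta>\<close> is the module end over the restricted module category.
\<close>

lemma linear_category_op_cat:
  assumes "linear_category K C"
  shows "linear_category K (op_cat C)"
proof -
  interpret linear_category K C by fact
  show ?thesis
  proof (intro linear_category.intro category.intro linear_category_axioms.intro)
    show "field K" by (rule field_axioms)
  next
    fix A B A' B' f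
    assume "A \<in> Ob (op_cat C)" "B \<in> Ob (op_cat C)" "A' \<in> Ob (op_cat C)" "B' \<in> Ob (op_cat C)"
      "f \<in> Hom (op_cat C) A B" "f \<in> Hom (op_cat C) A' B'"
    then show "A = A' \<and> B = B'"
      using Hom_disjoint[of B A B' A' f] by (simp add: op_cat_def)
  qed (auto simp: op_cat_def ide_in cmp_in ide_left ide_right cmp_assoc vectorspace_Mor
      cmp_linear_left cmp_linear_right)
qed

lemma linear_map_in:
  "\<lbrakk>linear_map K V W f; x \<in> carrier V\<rbrakk> \<Longrightarrow> f x \<in> carrier W"
  by (rule mod_hom.f_im[OF linear_map.axioms(3)])

lemma linear_map_comp:
  assumes f: "linear_map K U V f" and g: "linear_map K V W g"
  shows "linear_map K U W (\<lambda>x. g (f x))"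
proof -
  have "f \<in> LinearCombinations.module_hom K U V" "g \<in> LinearCombinations.module_hom K V W"
    using f g by (simp_all add: linear_map_def mod_hom_def mod_hom_axioms_def)
  then have "(\<lambda>x. g (f x)) \<in> LinearCombinations.module_hom K U W"
    by (auto simp: LinearCombinations.module_hom_def Pi_iff)
  then show ?thesis
    using f g by (simp add: linear_map_def mod_hom_def mod_hom_axioms_def)
qed

lemma (in category) arrow_inv_eq:
  assumes "A \<in> Ob C" "B \<in> Ob C" "inverse_arrows C A B f g"
  shows "arrow_inv C A B f = g"
  unfolding arrow_inv_def
proof (rule the_equality)
  fix h assume h: "inverse_arrows C A B f h"
  have "h = h \<bullet> (f \<bullet> g)"
    using assms h by (simp add: inverse_arrows_def ide_right)
  also have "\<dots> = (h \<bullet> f) \<bullet> g"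
    using assms h by (intro cmp_assoc[of B A B A, symmetric]) (auto simp: inverse_arrows_def)
  also have "\<dots> = g"
    using assms h by (simp add: inverse_arrows_def ide_left)
  finally show "h = g" .
qed (use assms in simp)

lemma (in category) arrow_inv_in:
  assumes "is_isom C A B f"
  shows "arrow_inv C A B f \<in> Hom C B A"
  using assms arrow_inv_eq unfolding is_isom_def inverse_arrows_def by metis

context linear_bifunctor
begin

lemma bmor_in: "\<lbrakk>X \<in> Ob B; X' \<in> Ob B; Y \<in> Ob C; Y' \<in> Ob C; f \<in> Hom B X X'; g \<in> Hom C Y Y'\<rbrakk>
    \<Longrightarrow> bmor F f g \<in> Hom D (bobj F X Y) (bobj F X' Y')"
  by (rule linear_map_in[OF bmor_linear_left])

end

context tensor_subcategory
begin

lemma Ob_sub: "X \<in> Ob D \<Longrightarrow> X \<in> Ob C"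
  by (rule incl.Fo_in)

lemma Hom_sub: "\<lbrakk>X \<in> Ob D; Y \<in> Ob D; f \<in> Hom D X Y\<rbrakk> \<Longrightarrow> f \<in> Hom C X Y"
  by (rule linear_map_in[OF incl.Fm_linear])

lemma ide_sub: "X \<in> Ob D \<Longrightarrow> ide D X = ide C X"
  by (rule incl.Fm_ide)

lemma arrow_inv_sub:
  assumes "is_isom D X Y f"
  shows "arrow_inv D X Y f = arrow_inv C X Y f"
proof -
  from assms obtain g where X: "X \<in> Ob D" and Y: "Y \<in> Ob D" and g: "inverse_arrows D X Y f g"
    by (auto simp: is_isom_def)
  have "inverse_arrows C X Y f g"
    using g X Y incl.Fm_cmp[OF X Y X, of f g] incl.Fm_cmp[OF Y X Y, of g f]
    by (auto simp: inverse_arrows_def Hom_sub ide_sub)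
  then show ?thesis
    using X Y g by (simp add: Ob_sub sub.arrow_inv_eq big.arrow_inv_eq)
qed

lemma dual_mor_sub:
  assumes X: "X \<in> Ob D" and Y: "Y \<in> Ob D" and f: "f \<in> Hom D X Y"
  shows "dual_mor D X Y f = dual_mor C X Y f"
    and "dual_mor D X Y f \<in> Hom D (dual D Y) (dual D X)"
proof -
  let ?X = "dual D X" and ?Y = "dual D Y" and ?I = "unitob D"
  have d: "?X \<in> Ob D" "?Y \<in> Ob D" "?I \<in> Ob D"
    using sub.left_dual[OF X] sub.left_dual[OF Y] sub.unitob_in by (auto simp: is_left_dual_def)
  have e: "ev D Y \<in> Hom D (?Y \<otimes>\<^sub>o\<^bsub>D\<^esub> Y) ?I" "coev D X \<in> Hom D ?I (X \<otimes>\<^sub>o\<^bsub>D\<^esub> ?X)"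
    using sub.left_dual[OF X] sub.left_dual[OF Y] by (auto simp: is_left_dual_def)
  note o = X Y d sub.bobj_in sub.ide_in
  define a1 where "a1 = arrow_inv D (?Y \<otimes>\<^sub>o\<^bsub>D\<^esub> ?I) ?Y (runit D ?Y)"
  define a2 where "a2 = ide D ?Y \<otimes>\<^sub>m\<^bsub>D\<^esub> coev D X"
  define a3 where "a3 = ide D ?Y \<otimes>\<^sub>m\<^bsub>D\<^esub> (f \<otimes>\<^sub>m\<^bsub>D\<^esub> ide D ?X)"
  define a4 where "a4 = arrow_inv D ((?Y \<otimes>\<^sub>o\<^bsub>D\<^esub> Y) \<otimes>\<^sub>o\<^bsub>D\<^esub> ?X) (?Y \<otimes>\<^sub>o\<^bsub>D\<^esub> (Y \<otimes>\<^sub>o\<^bsub>D\<^esub> ?X)) (asc D ?Y Y ?X)"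
  define a5 where "a5 = ev D Y \<otimes>\<^sub>m\<^bsub>D\<^esub> ide D ?X"
  have a1: "a1 \<in> Hom D ?Y (?Y \<otimes>\<^sub>o\<^bsub>D\<^esub> ?I)"
    unfolding a1_def by (intro sub.arrow_inv_in sub.runit_isom o)
  have a2: "a2 \<in> Hom D (?Y \<otimes>\<^sub>o\<^bsub>D\<^esub> ?I) (?Y \<otimes>\<^sub>o\<^bsub>D\<^esub> (X \<otimes>\<^sub>o\<^bsub>D\<^esub> ?X))"
    unfolding a2_def by (intro sub.bmor_in o e)
  have f1: "f \<otimes>\<^sub>m\<^bsub>D\<^esub> ide D ?X \<in> Hom D (X \<otimes>\<^sub>o\<^bsub>D\<^esub> ?X) (Y \<otimes>\<^sub>o\<^bsub>D\<^esub> ?X)"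
    by (intro sub.bmor_in o f)
  have a3: "a3 \<in> Hom D (?Y \<otimes>\<^sub>o\<^bsub>D\<^esub> (X \<otimes>\<^sub>o\<^bsub>D\<^esub> ?X)) (?Y \<otimes>\<^sub>o\<^bsub>D\<^esub> (Y \<otimes>\<^sub>o\<^bsub>D\<^esub> ?X))"
    unfolding a3_def by (intro sub.bmor_in o f1)
  have a4: "a4 \<in> Hom D (?Y \<otimes>\<^sub>o\<^bsub>D\<^esub> (Y \<otimes>\<^sub>o\<^bsub>D\<^esub> ?X)) ((?Y \<otimes>\<^sub>o\<^bsub>D\<^esub> Y) \<otimes>\<^sub>o\<^bsub>D\<^esub> ?X)"
    unfolding a4_def by (intro sub.arrow_inv_in sub.asc_isom o)
  have a5: "a5 \<in> Hom D ((?Y \<otimes>\<^sub>o\<^bsub>D\<^esub> Y) \<otimes>\<^sub>o\<^bsub>D\<^esub> ?X) (?I \<otimes>\<^sub>o\<^bsub>D\<^esub> ?X)"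
    unfolding a5_def by (intro sub.bmor_in o e)
  have a6: "lunit D ?X \<in> Hom D (?I \<otimes>\<^sub>o\<^bsub>D\<^esub> ?X) ?X"
    using sub.lunit_isom[OF d(1)] by (auto simp: is_isom_def inverse_arrows_def)
  have D: "dual_mor D X Y f = lunit D ?X \<bullet>\<^bsub>D\<^esub> a5 \<bullet>\<^bsub>D\<^esub> a4 \<bullet>\<^bsub>D\<^esub> a3 \<bullet>\<^bsub>D\<^esub> a2 \<bullet>\<^bsub>D\<^esub> a1"
    by (simp add: dual_mor_def a1_def a2_def a3_def a4_def a5_def)
  have c1: "a2 \<bullet>\<^bsub>D\<^esub> a1 \<in> Hom D ?Y (?Y \<otimes>\<^sub>o\<^bsub>D\<^esub> (X \<otimes>\<^sub>o\<^bsub>D\<^esub> ?X))"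
    by (rule sub.cmp_in[OF _ _ _ a1 a2]; intro o)
  have c2: "a3 \<bullet>\<^bsub>D\<^esub> a2 \<bullet>\<^bsub>D\<^esub> a1 \<in> Hom D ?Y (?Y \<otimes>\<^sub>o\<^bsub>D\<^esub> (Y \<otimes>\<^sub>o\<^bsub>D\<^esub> ?X))"
    by (rule sub.cmp_in[OF _ _ _ c1 a3]; intro o)
  have c3: "a4 \<bullet>\<^bsub>D\<^esub> a3 \<bullet>\<^bsub>D\<^esub> a2 \<bullet>\<^bsub>D\<^esub> a1 \<in> Hom D ?Y ((?Y \<otimes>\<^sub>o\<^bsub>D\<^esub> Y) \<otimes>\<^sub>o\<^bsub>D\<^esub> ?X)"
    by (rule sub.cmp_in[OF _ _ _ c2 a4]; intro o)
  have c4: "a5 \<bullet>\<^bsub>D\<^esub> a4 \<bullet>\<^bsub>D\<^esub> a3 \<bullet>\<^bsub>D\<^esub> a2 \<bullet>\<^bsub>D\<^esub> a1 \<in> Hom D ?Y (?I \<otimes>\<^sub>o\<^bsub>D\<^esub> ?X)"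
    by (rule sub.cmp_in[OF _ _ _ c3 a5]; intro o)
  show "dual_mor D X Y f \<in> Hom D ?Y ?X"
    unfolding D by (rule sub.cmp_in[OF _ _ _ c4 a6]; intro o)
  have "dual_mor D X Y f = lunit D ?X \<bullet>\<^bsub>C\<^esub> a5 \<bullet>\<^bsub>C\<^esub> a4 \<bullet>\<^bsub>C\<^esub> a3 \<bullet>\<^bsub>C\<^esub> a2 \<bullet>\<^bsub>C\<^esub> a1"
    unfolding D
    using incl.Fm_cmp[OF _ _ _ a1 a2] incl.Fm_cmp[OF _ _ _ c1 a3] incl.Fm_cmp[OF _ _ _ c2 a4]
      incl.Fm_cmp[OF _ _ _ c3 a5] incl.Fm_cmp[OF _ _ _ c4 a6] by (simp add: o)
  moreover have "a1 = arrow_inv C (dual C Y \<otimes>\<^sub>o\<^bsub>C\<^esub> unitob C) (dual C Y) (runit C (dual C Y))"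
    unfolding a1_def using arrow_inv_sub[OF sub.runit_isom[OF d(2)]] d Y
    by (simp add: unitob_eq dual_eq tens_ob_eq runit_eq)
  moreover have "a2 = ide C (dual C Y) \<otimes>\<^sub>m\<^bsub>C\<^esub> coev C X"
    unfolding a2_def using tens_mor_eq[OF _ _ _ _ sub.ide_in e(2), of ?Y] o
    by (simp add: dual_eq coev_eq ide_sub)
  moreover have "a3 = ide C (dual C Y) \<otimes>\<^sub>m\<^bsub>C\<^esub> (f \<otimes>\<^sub>m\<^bsub>C\<^esub> ide C (dual C X))"
    unfolding a3_def using tens_mor_eq[OF _ _ _ _ sub.ide_in f1, of ?Y]
      tens_mor_eq[OF _ _ _ _ f sub.ide_in, of ?X] o
    by (simp add: dual_eq ide_sub)
  moreover have "a4 = arrow_inv C ((dual C Y \<otimes>\<^sub>o\<^bsub>C\<^esub> Y) \<otimes>\<^sub>o\<^bsub>C\<^esub> dual C X)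
      (dual C Y \<otimes>\<^sub>o\<^bsub>C\<^esub> (Y \<otimes>\<^sub>o\<^bsub>C\<^esub> dual C X)) (asc C (dual C Y) Y (dual C X))"
  proof -
    have "?Y \<otimes>\<^sub>o\<^bsub>D\<^esub> Y \<in> Ob D" "Y \<otimes>\<^sub>o\<^bsub>D\<^esub> ?X \<in> Ob D"
      by (intro o)+
    then have "(?Y \<otimes>\<^sub>o\<^bsub>D\<^esub> Y) \<otimes>\<^sub>o\<^bsub>D\<^esub> ?X = (?Y \<otimes>\<^sub>o\<^bsub>C\<^esub> Y) \<otimes>\<^sub>o\<^bsub>C\<^esub> ?X"
      "?Y \<otimes>\<^sub>o\<^bsub>D\<^esub> (Y \<otimes>\<^sub>o\<^bsub>D\<^esub> ?X) = ?Y \<otimes>\<^sub>o\<^bsub>C\<^esub> (Y \<otimes>\<^sub>o\<^bsub>C\<^esub> ?X)"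
      using d Y by (simp_all add: tens_ob_eq)
    then show ?thesis
      unfolding a4_def arrow_inv_sub[OF sub.asc_isom[OF d(2) Y d(1)]]
      using X Y asc_eq[OF d(2) Y d(1)] by (simp add: dual_eq)
  qed
  moreover have "a5 = ev C Y \<otimes>\<^sub>m\<^bsub>C\<^esub> ide C (dual C X)"
    unfolding a5_def using tens_mor_eq[OF _ _ _ _ e(1) sub.ide_in, of ?X] o
    by (simp add: dual_eq ev_eq ide_sub)
  moreover have "lunit D ?X = lunit C (dual C X)"
    using X d by (simp add: lunit_eq dual_eq)
  ultimately show "dual_mor D X Y f = dual_mor C X Y f"
    by (simp add: dual_mor_def)
qed

lemma module_category_restrict:
  assumes "module_category K C M"
  shows "module_category K D M"
proof -
  interpret M: module_category K C M by fact
  interpret A: linear_bifunctor K D M M "act M"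
  proof (intro linear_bifunctor.intro linear_bifunctor_axioms.intro
      sub.linear_category_axioms M.linear_category_axioms)
    fix X X' Y Y' g
    assume "X \<in> Ob D" "X' \<in> Ob D" "Y \<in> Ob M" "Y' \<in> Ob M" "g \<in> Hom M Y Y'"
    then show "linear_map K (Mor D X X') (Mor M (X \<rhd>\<^sub>o\<^bsub>M\<^esub> Y) (X' \<rhd>\<^sub>o\<^bsub>M\<^esub> Y')) (\<lambda>f. f \<rhd>\<^sub>m\<^bsub>M\<^esub> g)"
      using linear_map_comp[OF incl.Fm_linear M.bmor_linear_left] Ob_sub by blast
  next
    fix X X' X'' Y Y' Y'' f f' g g'
    assume *: "X \<in> Ob D" "X' \<in> Ob D" "X'' \<in> Ob D" "Y \<in> Ob M" "Y' \<in> Ob M" "Y'' \<in> Ob M"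
      "f \<in> Hom D X X'" "f' \<in> Hom D X' X''" "g \<in> Hom M Y Y'" "g' \<in> Hom M Y' Y''"
    then have "f' \<bullet>\<^bsub>D\<^esub> f = f' \<bullet>\<^bsub>C\<^esub> f"
      by (intro incl.Fm_cmp)
    with * show "(f' \<bullet>\<^bsub>D\<^esub> f) \<rhd>\<^sub>m\<^bsub>M\<^esub> (g' \<bullet>\<^bsub>M\<^esub> g) = (f' \<rhd>\<^sub>m\<^bsub>M\<^esub> g') \<bullet>\<^bsub>M\<^esub> (f \<rhd>\<^sub>m\<^bsub>M\<^esub> g)"
      using M.bmor_cmp[of X X' X'' Y Y' Y'' f f' g g'] by (simp add: Ob_sub Hom_sub)
  qed (auto simp: M.bobj_in M.bmor_linear_right Ob_sub Hom_sub ide_sub M.bmor_ide)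
  have ex: "exact_functor K D M (\<lambda>X. X \<rhd>\<^sub>o\<^bsub>M\<^esub> N) (\<lambda>f. f \<rhd>\<^sub>m\<^bsub>M\<^esub> ide M N)" if "N \<in> Ob M" for N
  proof -
    interpret E: exact_functor K C M "\<lambda>X. X \<rhd>\<^sub>o\<^bsub>M\<^esub> N" "\<lambda>f. f \<rhd>\<^sub>m\<^bsub>M\<^esub> ide M N"
      using that by (rule M.exact_left)
    show ?thesis
    proof (intro exact_functor.intro exact_functor_axioms.intro linear_functor.intro
        linear_functor_axioms.intro sub.linear_category_axioms M.linear_category_axioms)
      fix A B assume "A \<in> Ob D" "B \<in> Ob D"
      then show "linear_map K (Mor D A B) (Mor M (A \<rhd>\<^sub>o\<^bsub>M\<^esub> N) (B \<rhd>\<^sub>o\<^bsub>M\<^esub> N)) (\<lambda>f. f \<rhd>\<^sub>m\<^bsub>M\<^esub> ide M N)"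
        using linear_map_comp[OF incl.Fm_linear E.Fm_linear] Ob_sub by blast
    next
      fix A B E f g assume "A \<in> Ob D" "B \<in> Ob D" "E \<in> Ob D" "f \<in> Hom D A B" "g \<in> Hom D B E"
      then show "(g \<bullet>\<^bsub>D\<^esub> f) \<rhd>\<^sub>m\<^bsub>M\<^esub> ide M N = (g \<rhd>\<^sub>m\<^bsub>M\<^esub> ide M N) \<bullet>\<^bsub>M\<^esub> (f \<rhd>\<^sub>m\<^bsub>M\<^esub> ide M N)"
        using incl.Fm_cmp[of A B E f g] E.Fm_cmp[of A B E f g] by (simp add: Ob_sub Hom_sub)
    next
      fix X Y Z f g assume "short_exact D X Y Z f g"
      then show "short_exact M (X \<rhd>\<^sub>o\<^bsub>M\<^esub> N) (Y \<rhd>\<^sub>o\<^bsub>M\<^esub> N) (Z \<rhd>\<^sub>o\<^bsub>M\<^esub> N)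
          (f \<rhd>\<^sub>m\<^bsub>M\<^esub> ide M N) (g \<rhd>\<^sub>m\<^bsub>M\<^esub> ide M N)"
        by (intro E.preserves_short_exact incl.preserves_short_exact)
    qed (auto simp: E.Fo_in E.Fm_ide Ob_sub ide_sub)
  qed
  show ?thesis
  proof (intro module_category.intro module_category_axioms.intro sub.tensor_category_axioms
      M.finite_abelian_category_axioms A.linear_bifunctor_axioms)
    fix X X' Y Y' N N' f g h
    assume *: "X \<in> Ob D" "X' \<in> Ob D" "Y \<in> Ob D" "Y' \<in> Ob D" "N \<in> Ob M" "N' \<in> Ob M"
      "f \<in> Hom D X X'" "g \<in> Hom D Y Y'" "h \<in> Hom M N N'"
    then have "f \<otimes>\<^sub>m\<^bsub>D\<^esub> g = f \<otimes>\<^sub>m\<^bsub>C\<^esub> g"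
      by (intro tens_mor_eq)
    with * show "masc M X' Y' N' \<bullet>\<^bsub>M\<^esub> ((f \<otimes>\<^sub>m\<^bsub>D\<^esub> g) \<rhd>\<^sub>m\<^bsub>M\<^esub> h) = (f \<rhd>\<^sub>m\<^bsub>M\<^esub> (g \<rhd>\<^sub>m\<^bsub>M\<^esub> h)) \<bullet>\<^bsub>M\<^esub> masc M X Y N"
      using M.masc_natural[of X X' Y Y' N N' f g h] by (simp add: Ob_sub Hom_sub)
  qed (auto simp: ex M.exact_right M.masc_isom M.munit_isom M.munit_natural M.mpentagon M.mtriangle
      Ob_sub ide_sub unitob_eq tens_ob_eq asc_eq runit_eq sub.unitob_in[unfolded unitob_eq])
qed

lemma pre_balancing_restrict:
  assumes "pre_balancing K C \<M> \<A> S \<beta>"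
  shows "pre_balancing K D \<M> \<A> S \<beta>"
proof -
  interpret P: pre_balancing K C \<M> \<A> S \<beta> by fact
  interpret R: module_category K D \<M>
    by (rule module_category_restrict) (rule P.module_category_axioms)
  show ?thesis
    by (intro pre_balancing.intro pre_balancing_axioms.intro R.module_category_axioms
        P.\<A>.finite_abelian_category_axioms P.S.linear_bifunctor_axioms)
      (auto simp: P.\<beta>_isom Ob_sub dual_eq dual_mor_sub Hom_sub intro!: P.\<beta>_natural)
qed

end

end

theory Submission
  imports Defs
begin

text \<open>
  The module end over \<open>C\<close> is a universal cone for the dinaturality equations together with one
  equation for each \<open>X \<in> C\<close>; passing to \<open>D \<subseteq> C\<close> only discards those for \<open>X \<notin> D\<close>.  So the cone
  of the \<open>C\<close>-end is also a cone for \<open>D\<close> (\<open>end_cone_restrict\<close>) and factors as \<open>\<pi>\<^sub>M = \<pi>'\<^sub>M \<circ> \<iota>\<close>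
  through the cone \<open>\<pi>'\<close> of the \<open>D\<close>-end.  Now the legs \<open>\<pi>\<^sub>M\<close> are jointly monic: cones may be
  precomposed with arbitrary morphisms (\<open>end_cone_precompose\<close>), so the uniqueness half of
  universality says that a morphism into the end is determined by its composites with the legs
  (\<open>module_end_jointly_monic\<close>).  A morphism through which a jointly monic family factors is monic;
  hence \<open>\<iota>\<close> is.  The statement for coends is the same argument with all arrows of the target
  category reversed.
\<close>

section \<open>Typing of the structure morphisms\<close>

text \<open>
  The contravariant variable of \<open>S\<close> ranges over the opposite category; this is the typing of
  \<open>bmor S\<close> with that category unfolded.
\<close>

lemma (in pre_balancing) bmor_S_in:
  assumes "M \<in> Ob \<M>" "M' \<in> Ob \<M>" "N \<in> Ob \<M>" "N' \<in> Ob \<M>"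
    and "f \<in> Hom \<M> M' M" "g \<in> Hom \<M> N N'"
  shows "bmor S f g \<in> Hom \<A> (bobj S M N) (bobj S M' N')"
  using S.bmor_in[of M M' N N' f g] assms by (simp add: op_cat_def)

lemma (in pre_balancing) bobj_S_in:
  "\<lbrakk>M \<in> Ob \<M>; N \<in> Ob \<M>\<rbrakk> \<Longrightarrow> bobj S M N \<in> Ob \<A>"
  using S.bobj_in[of M N] by (simp add: op_cat_def)

lemma (in tensor_category) dual_in: "X \<in> Ob C \<Longrightarrow> dual C X \<in> Ob C"
  using left_dual by (simp add: is_left_dual_def)

lemma is_isom_in: "is_isom C A B f \<Longrightarrow> f \<in> Hom C A B"
  by (auto simp: is_isom_def inverse_arrows_def)

lemma (in pre_balancing) \<beta>_in:
  "\<lbrakk>X \<in> Ob C; M \<in> Ob \<M>; N \<in> Ob \<M>\<rbrakk>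
    \<Longrightarrow> \<beta> X M N \<in> Hom \<A> (bobj S M (X \<rhd>\<^sub>o\<^bsub>\<M>\<^esub> N)) (bobj S (dual C X \<rhd>\<^sub>o\<^bsub>\<M>\<^esub> M) N)"
  by (rule is_isom_in[OF \<beta>_isom])

lemma (in module_category) ev_act_in:
  assumes X: "X \<in> Ob C" and N: "N \<in> Ob M"
  shows "munit M N \<bullet>\<^bsub>M\<^esub> (ev C X \<rhd>\<^sub>m\<^bsub>M\<^esub> ide M N) \<in> Hom M ((dual C X \<otimes>\<^sub>o\<^bsub>C\<^esub> X) \<rhd>\<^sub>o\<^bsub>M\<^esub> N) N"
proof -
  have e: "ev C X \<in> Hom C (dual C X \<otimes>\<^sub>o\<^bsub>C\<^esub> X) (unitob C)"
    using acting.left_dual[OF X] by (simp add: is_left_dual_def)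
  note o = X N acting.dual_in acting.bobj_in acting.unitob_in bobj_in ide_in
  have "ev C X \<rhd>\<^sub>m\<^bsub>M\<^esub> ide M N
      \<in> Hom M ((dual C X \<otimes>\<^sub>o\<^bsub>C\<^esub> X) \<rhd>\<^sub>o\<^bsub>M\<^esub> N) (unitob C \<rhd>\<^sub>o\<^bsub>M\<^esub> N)"
    by (intro bmor_in e o)
  then show ?thesis
    by (rule cmp_in[OF _ _ _ _ is_isom_in[OF munit_isom[OF N]], rotated 3]; intro o)
qed

lemma (in module_category) coev_act_in:
  assumes X: "X \<in> Ob C" and N: "N \<in> Ob M"
  shows "(coev C X \<rhd>\<^sub>m\<^bsub>M\<^esub> ide M N) \<bullet>\<^bsub>M\<^esub> arrow_inv M (unitob C \<rhd>\<^sub>o\<^bsub>M\<^esub> N) N (munit M N)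
    \<in> Hom M N ((X \<otimes>\<^sub>o\<^bsub>C\<^esub> dual C X) \<rhd>\<^sub>o\<^bsub>M\<^esub> N)"
proof -
  have c: "coev C X \<in> Hom C (unitob C) (X \<otimes>\<^sub>o\<^bsub>C\<^esub> dual C X)"
    using acting.left_dual[OF X] by (simp add: is_left_dual_def)
  note o = X N acting.dual_in acting.bobj_in acting.unitob_in bobj_in ide_in
  have "coev C X \<rhd>\<^sub>m\<^bsub>M\<^esub> ide M N
      \<in> Hom M (unitob C \<rhd>\<^sub>o\<^bsub>M\<^esub> N) ((X \<otimes>\<^sub>o\<^bsub>C\<^esub> dual C X) \<rhd>\<^sub>o\<^bsub>M\<^esub> N)"
    by (intro bmor_in c o)
  then show ?thesis
    by (rule cmp_in[OF _ _ _ arrow_inv_in[OF munit_isom[OF N]], rotated 3]; intro o)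
qed

section \<open>Composing cones with morphisms\<close>

text \<open>
  Every equation of a cone compares two composites that begin with a leg, so it survives
  composition with \<open>g\<close> on that side; the proof consists in moving \<open>g\<close> past the associations.
\<close>

lemma (in pre_balancing) end_cone_precompose:
  assumes cone: "end_cone C \<M> \<A> S \<beta> E \<pi>" and F: "F \<in> Ob \<A>" and g: "g \<in> Hom \<A> F E"
  shows "end_cone C \<M> \<A> S \<beta> F (\<lambda>M. \<pi> M \<bullet>\<^bsub>\<A>\<^esub> g)"
proof -
  have E: "E \<in> Ob \<A>" and \<pi>: "\<And>M. M \<in> Ob \<M> \<Longrightarrow> \<pi> M \<in> Hom \<A> E (bobj S M M)"
    using cone by (auto simp: end_cone_def dinatural_from_def)
  note o = E F bobj_S_in bobj_in acting.bobj_in acting.dual_in ide_in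
  have shift: "s \<bullet>\<^bsub>\<A>\<^esub> (\<pi> M \<bullet>\<^bsub>\<A>\<^esub> g) = (s \<bullet>\<^bsub>\<A>\<^esub> \<pi> M) \<bullet>\<^bsub>\<A>\<^esub> g"
    if "M \<in> Ob \<M>" "B \<in> Ob \<A>" "s \<in> Hom \<A> (bobj S M M) B" for s M B
    by (rule \<A>.cmp_assoc[symmetric]) (use that g in \<open>auto intro: o \<pi>\<close>)
  have dinat: "bmor S (ide \<M> M) f \<bullet>\<^bsub>\<A>\<^esub> (\<pi> M \<bullet>\<^bsub>\<A>\<^esub> g) = bmor S f (ide \<M> N) \<bullet>\<^bsub>\<A>\<^esub> (\<pi> N \<bullet>\<^bsub>\<A>\<^esub> g)"
    if "M \<in> Ob \<M>" "N \<in> Ob \<M>" "f \<in> Hom \<M> M N" for M N f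
  proof -
    have s: "bmor S (ide \<M> M) f \<in> Hom \<A> (bobj S M M) (bobj S M N)"
      "bmor S f (ide \<M> N) \<in> Hom \<A> (bobj S N N) (bobj S M N)"
      by (intro bmor_S_in ide_in that)+
    have "bmor S (ide \<M> M) f \<bullet>\<^bsub>\<A>\<^esub> \<pi> M = bmor S f (ide \<M> N) \<bullet>\<^bsub>\<A>\<^esub> \<pi> N"
      using cone that by (simp add: end_cone_def dinatural_from_def)
    then show ?thesis
      using shift[OF _ _ s(1)] shift[OF _ _ s(2)] that by (simp add: bobj_S_in)
  qed
  have bal: "bmor S (munit \<M> M \<bullet>\<^bsub>\<M>\<^esub> (ev C X \<rhd>\<^sub>m\<^bsub>\<M>\<^esub> ide \<M> M)) (ide \<M> M) \<bullet>\<^bsub>\<A>\<^esub> (\<pi> M \<bullet>\<^bsub>\<A>\<^esub> g) =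
      bmor S (masc \<M> (dual C X) X M) (ide \<M> M) \<bullet>\<^bsub>\<A>\<^esub> \<beta> X (X \<rhd>\<^sub>o\<^bsub>\<M>\<^esub> M) M
        \<bullet>\<^bsub>\<A>\<^esub> (\<pi> (X \<rhd>\<^sub>o\<^bsub>\<M>\<^esub> M) \<bullet>\<^bsub>\<A>\<^esub> g)"
    (is "?u \<bullet>\<^bsub>\<A>\<^esub> _ = ?v \<bullet>\<^bsub>\<A>\<^esub> ?b \<bullet>\<^bsub>\<A>\<^esub> _")
    if X: "X \<in> Ob C" and M: "M \<in> Ob \<M>" for X M
  proof -
    let ?W = "(dual C X \<otimes>\<^sub>o\<^bsub>C\<^esub> X) \<rhd>\<^sub>o\<^bsub>\<M>\<^esub> M" and ?V = "dual C X \<rhd>\<^sub>o\<^bsub>\<M>\<^esub> (X \<rhd>\<^sub>o\<^bsub>\<M>\<^esub> M)"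
      and ?N = "X \<rhd>\<^sub>o\<^bsub>\<M>\<^esub> M"
    have u: "?u \<in> Hom \<A> (bobj S M M) (bobj S ?W M)"
      by (intro bmor_S_in ev_act_in X M o)
    have b: "?b \<in> Hom \<A> (bobj S ?N ?N) (bobj S ?V M)"
      by (intro \<beta>_in X M o)
    have v: "?v \<in> Hom \<A> (bobj S ?V M) (bobj S ?W M)"
      by (intro bmor_S_in is_isom_in[OF masc_isom] X M o)
    have N: "?N \<in> Ob \<M>" and S: "bobj S ?N ?N \<in> Ob \<A>" "bobj S ?V M \<in> Ob \<A>" "bobj S ?W M \<in> Ob \<A>"
      by (intro X M o)+
    have b\<pi>: "?b \<bullet>\<^bsub>\<A>\<^esub> \<pi> ?N \<in> Hom \<A> E (bobj S ?V M)"
      by (rule \<A>.cmp_in[OF E S(1,2) \<pi>[OF N] b])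
    have "?u \<bullet>\<^bsub>\<A>\<^esub> (\<pi> M \<bullet>\<^bsub>\<A>\<^esub> g) = (?u \<bullet>\<^bsub>\<A>\<^esub> \<pi> M) \<bullet>\<^bsub>\<A>\<^esub> g"
      by (rule shift[OF M S(3) u])
    also have "\<dots> = (?v \<bullet>\<^bsub>\<A>\<^esub> (?b \<bullet>\<^bsub>\<A>\<^esub> \<pi> ?N)) \<bullet>\<^bsub>\<A>\<^esub> g"
      using cone X M by (simp add: end_cone_def)
    also have "\<dots> = ?v \<bullet>\<^bsub>\<A>\<^esub> ((?b \<bullet>\<^bsub>\<A>\<^esub> \<pi> ?N) \<bullet>\<^bsub>\<A>\<^esub> g)"
      by (rule \<A>.cmp_assoc[OF F E S(2,3) g b\<pi> v])
    also have "(?b \<bullet>\<^bsub>\<A>\<^esub> \<pi> ?N) \<bullet>\<^bsub>\<A>\<^esub> g = ?b \<bullet>\<^bsub>\<A>\<^esub> (\<pi> ?N \<bullet>\<^bsub>\<A>\<^esub> g)"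
      by (rule shift[OF N S(2) b, symmetric])
    finally show ?thesis .
  qed
  have "\<pi> M \<bullet>\<^bsub>\<A>\<^esub> g \<in> Hom \<A> F (bobj S M M)" if "M \<in> Ob \<M>" for M
    by (rule \<A>.cmp_in[OF F E _ g \<pi>[OF that]]) (intro o that)
  then show ?thesis
    unfolding end_cone_def dinatural_from_def using F dinat bal by blast
qed

lemma (in pre_balancing) coend_cocone_postcompose:
  assumes cocone: "coend_cocone C \<M> \<A> S \<beta> E \<pi>" and F: "F \<in> Ob \<A>" and g: "g \<in> Hom \<A> E F"
  shows "coend_cocone C \<M> \<A> S \<beta> F (\<lambda>M. g \<bullet>\<^bsub>\<A>\<^esub> \<pi> M)"
proof -
  have E: "E \<in> Ob \<A>" and \<pi>: "\<And>M. M \<in> Ob \<M> \<Longrightarrow> \<pi> M \<in> Hom \<A> (bobj S M M) E"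
    using cocone by (auto simp: coend_cocone_def dinatural_to_def)
  note o = E F bobj_S_in bobj_in acting.bobj_in acting.dual_in ide_in
  have shift: "(g \<bullet>\<^bsub>\<A>\<^esub> \<pi> M) \<bullet>\<^bsub>\<A>\<^esub> s = g \<bullet>\<^bsub>\<A>\<^esub> (\<pi> M \<bullet>\<^bsub>\<A>\<^esub> s)"
    if "M \<in> Ob \<M>" "B \<in> Ob \<A>" "s \<in> Hom \<A> B (bobj S M M)" for s M B
    by (rule \<A>.cmp_assoc) (use that g in \<open>auto intro: o \<pi>\<close>)
  have dinat: "(g \<bullet>\<^bsub>\<A>\<^esub> \<pi> M) \<bullet>\<^bsub>\<A>\<^esub> bmor S f (ide \<M> M) = (g \<bullet>\<^bsub>\<A>\<^esub> \<pi> N) \<bullet>\<^bsub>\<A>\<^esub> bmor S (ide \<M> N) f"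
    if "M \<in> Ob \<M>" "N \<in> Ob \<M>" "f \<in> Hom \<M> M N" for M N f
  proof -
    have s: "bmor S f (ide \<M> M) \<in> Hom \<A> (bobj S N M) (bobj S M M)"
      "bmor S (ide \<M> N) f \<in> Hom \<A> (bobj S N M) (bobj S N N)"
      by (intro bmor_S_in ide_in that)+
    have "\<pi> M \<bullet>\<^bsub>\<A>\<^esub> bmor S f (ide \<M> M) = \<pi> N \<bullet>\<^bsub>\<A>\<^esub> bmor S (ide \<M> N) f"
      using cocone that by (simp add: coend_cocone_def dinatural_to_def)
    then show ?thesis
      using shift[OF _ _ s(1)] shift[OF _ _ s(2)] that by (simp add: bobj_S_in)
  qed
  have bal: "g \<bullet>\<^bsub>\<A>\<^esub> \<pi> M = (g \<bullet>\<^bsub>\<A>\<^esub> \<pi> (dual C X \<rhd>\<^sub>o\<^bsub>\<M>\<^esub> M)) \<bullet>\<^bsub>\<A>\<^esub> \<beta> X M (dual C X \<rhd>\<^sub>o\<^bsub>\<M>\<^esub> M)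
        \<bullet>\<^bsub>\<A>\<^esub> bmor S (ide \<M> M) (masc \<M> X (dual C X) M)
        \<bullet>\<^bsub>\<A>\<^esub> bmor S (ide \<M> M)
            ((coev C X \<rhd>\<^sub>m\<^bsub>\<M>\<^esub> ide \<M> M) \<bullet>\<^bsub>\<M>\<^esub> arrow_inv \<M> (unitob C \<rhd>\<^sub>o\<^bsub>\<M>\<^esub> M) M (munit \<M> M))"
    (is "_ = _ \<bullet>\<^bsub>\<A>\<^esub> ?b \<bullet>\<^bsub>\<A>\<^esub> ?v \<bullet>\<^bsub>\<A>\<^esub> ?u")
    if X: "X \<in> Ob C" and M: "M \<in> Ob \<M>" for X M
  proof -
    let ?W = "(X \<otimes>\<^sub>o\<^bsub>C\<^esub> dual C X) \<rhd>\<^sub>o\<^bsub>\<M>\<^esub> M" and ?V = "X \<rhd>\<^sub>o\<^bsub>\<M>\<^esub> (dual C X \<rhd>\<^sub>o\<^bsub>\<M>\<^esub> M)"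
      and ?N = "dual C X \<rhd>\<^sub>o\<^bsub>\<M>\<^esub> M"
    have u: "?u \<in> Hom \<A> (bobj S M M) (bobj S M ?W)"
      by (intro bmor_S_in coev_act_in X M o)
    have v: "?v \<in> Hom \<A> (bobj S M ?W) (bobj S M ?V)"
      by (intro bmor_S_in is_isom_in[OF masc_isom] X M o)
    have b: "?b \<in> Hom \<A> (bobj S M ?V) (bobj S ?N ?N)"
      by (intro \<beta>_in X M o)
    have N: "?N \<in> Ob \<M>" and S: "bobj S M M \<in> Ob \<A>" "bobj S M ?W \<in> Ob \<A>" "bobj S M ?V \<in> Ob \<A>"
        "bobj S ?N ?N \<in> Ob \<A>"
      by (intro X M o)+
    have "?b \<bullet>\<^bsub>\<A>\<^esub> ?v \<bullet>\<^bsub>\<A>\<^esub> ?u \<in> Hom \<A> (bobj S M M) (bobj S ?N ?N)"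
      by (rule \<A>.cmp_in[OF S(1,3,4) \<A>.cmp_in[OF S(1,2,3) u v] b])
    from shift[OF N S(1) this] show ?thesis
      using cocone X M by (simp add: coend_cocone_def)
  qed
  have "g \<bullet>\<^bsub>\<A>\<^esub> \<pi> M \<in> Hom \<A> (bobj S M M) F" if "M \<in> Ob \<M>" for M
    by (rule \<A>.cmp_in[OF _ E F \<pi>[OF that] g]) (intro o that)
  then show ?thesis
    unfolding coend_cocone_def dinatural_to_def using F dinat bal by blast
qed

section \<open>Legs of a module end and comparison morphisms\<close>

text \<open>
  Both \<open>g\<close> and \<open>h\<close> factor one and the same cone, obtained by precomposing the universal one.
\<close>

lemma (in pre_balancing) module_end_jointly_monic:
  assumes "is_module_end C \<M> \<A> S \<beta> E \<pi>" and "F \<in> Ob \<A>" and "g \<in> Hom \<A> F E" "h \<in> Hom \<A> F E"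
    and "\<And>M. M \<in> Ob \<M> \<Longrightarrow> \<pi> M \<bullet>\<^bsub>\<A>\<^esub> g = \<pi> M \<bullet>\<^bsub>\<A>\<^esub> h"
  shows "g = h"
proof -
  have "end_cone C \<M> \<A> S \<beta> F (\<lambda>M. \<pi> M \<bullet>\<^bsub>\<A>\<^esub> g)"
    using assms by (intro end_cone_precompose) (auto simp: is_module_end_def)
  then have "\<exists>!k. k \<in> Hom \<A> F E \<and> (\<forall>M\<in>Ob \<M>. \<pi> M \<bullet>\<^bsub>\<A>\<^esub> g = \<pi> M \<bullet>\<^bsub>\<A>\<^esub> k)"
    using assms(1) unfolding is_module_end_def by fast
  then show ?thesis
    using assms(3-5) by blast
qed

lemma (in pre_balancing) module_coend_jointly_epic:
  assumes "is_module_coend C \<M> \<A> S \<beta> E \<pi>" and "F \<in> Ob \<A>" and "g \<in> Hom \<A> E F" "h \<in> Hom \<A> E F"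
    and "\<And>M. M \<in> Ob \<M> \<Longrightarrow> g \<bullet>\<^bsub>\<A>\<^esub> \<pi> M = h \<bullet>\<^bsub>\<A>\<^esub> \<pi> M"
  shows "g = h"
proof -
  have "coend_cocone C \<M> \<A> S \<beta> F (\<lambda>M. g \<bullet>\<^bsub>\<A>\<^esub> \<pi> M)"
    using assms by (intro coend_cocone_postcompose) (auto simp: is_module_coend_def)
  then have "\<exists>!k. k \<in> Hom \<A> E F \<and> (\<forall>M\<in>Ob \<M>. g \<bullet>\<^bsub>\<A>\<^esub> \<pi> M = k \<bullet>\<^bsub>\<A>\<^esub> \<pi> M)"
    using assms(1) unfolding is_module_coend_def by fast
  then show ?thesis
    using assms(3-5) by blast
qed

text \<open>
  If \<open>i \<circ> g = i \<circ> h\<close>, then composing with \<open>\<pi>'\<^sub>M\<close> shows that \<open>g\<close> and \<open>h\<close> agree after every leg \<open>\<pi>\<^sub>M\<close>.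
\<close>

lemma (in pre_balancing) module_end_factor_monic:
  assumes E: "is_module_end C \<M> \<A> S \<beta> E \<pi>" and E': "dinatural_from \<M> \<A> S E' \<pi>'"
    and i: "i \<in> Hom \<A> E E'" and fac: "\<And>M. M \<in> Ob \<M> \<Longrightarrow> \<pi> M = \<pi>' M \<bullet>\<^bsub>\<A>\<^esub> i"
  shows "is_monic \<A> E E' i"
proof -
  have ob: "E \<in> Ob \<A>" "E' \<in> Ob \<A>"
    and \<pi>': "\<And>M. M \<in> Ob \<M> \<Longrightarrow> \<pi>' M \<in> Hom \<A> E' (bobj S M M)"
    using E E' by (auto simp: is_module_end_def end_cone_def dinatural_from_def)
  have "g = h"
    if F: "F \<in> Ob \<A>" and gh: "g \<in> Hom \<A> F E" "h \<in> Hom \<A> F E"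
      and eq: "i \<bullet>\<^bsub>\<A>\<^esub> g = i \<bullet>\<^bsub>\<A>\<^esub> h" for F g h
  proof (rule module_end_jointly_monic[OF E F gh])
    fix M assume M: "M \<in> Ob \<M>"
    have "\<pi> M \<bullet>\<^bsub>\<A>\<^esub> k = \<pi>' M \<bullet>\<^bsub>\<A>\<^esub> (i \<bullet>\<^bsub>\<A>\<^esub> k)" if "k \<in> Hom \<A> F E" for k
      using \<A>.cmp_assoc[OF F ob bobj_S_in[OF M M] that i \<pi>'[OF M]] fac[OF M] by simp
    then show "\<pi> M \<bullet>\<^bsub>\<A>\<^esub> g = \<pi> M \<bullet>\<^bsub>\<A>\<^esub> h"
      using gh eq by simp
  qed
  then show ?thesis
    using ob i by (auto simp: is_monic_def)
qed

lemma (in pre_balancing) module_coend_factor_epic: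
  assumes E: "is_module_coend C \<M> \<A> S \<beta> E \<pi>" and E': "dinatural_to \<M> \<A> S E' \<pi>'"
    and p: "p \<in> Hom \<A> E' E" and fac: "\<And>M. M \<in> Ob \<M> \<Longrightarrow> \<pi> M = p \<bullet>\<^bsub>\<A>\<^esub> \<pi>' M"
  shows "is_epic \<A> E' E p"
proof -
  have ob: "E' \<in> Ob \<A>" "E \<in> Ob \<A>"
    and \<pi>': "\<And>M. M \<in> Ob \<M> \<Longrightarrow> \<pi>' M \<in> Hom \<A> (bobj S M M) E'"
    using E E' by (auto simp: is_module_coend_def coend_cocone_def dinatural_to_def)
  have "g = h"
    if F: "F \<in> Ob \<A>" and gh: "g \<in> Hom \<A> E F" "h \<in> Hom \<A> E F"
      and eq: "g \<bullet>\<^bsub>\<A>\<^esub> p = h \<bullet>\<^bsub>\<A>\<^esub> p" for F g h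
  proof (rule module_coend_jointly_epic[OF E F gh])
    fix M assume M: "M \<in> Ob \<M>"
    have "k \<bullet>\<^bsub>\<A>\<^esub> \<pi> M = (k \<bullet>\<^bsub>\<A>\<^esub> p) \<bullet>\<^bsub>\<A>\<^esub> \<pi>' M" if "k \<in> Hom \<A> E F" for k
      using \<A>.cmp_assoc[OF bobj_S_in[OF M M] ob F \<pi>'[OF M] p that] fac[OF M] by simp
    then show "g \<bullet>\<^bsub>\<A>\<^esub> \<pi> M = h \<bullet>\<^bsub>\<A>\<^esub> \<pi> M"
      using gh eq by simp
  qed
  then show ?thesis
    using ob p by (auto simp: is_epic_def)
qed

section \<open>Restriction to the subcategory\<close>

text \<open>
  Dinaturality does not refer to the acting category, and \<open>D\<close> has the duals, (co)evaluations and
  unit of \<open>C\<close>, so that its balancing equations are literally among those of \<open>C\<close>.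
\<close>

lemma (in tensor_subcategory) end_cone_restrict:
  "end_cone C \<M> \<A> S \<beta> E \<pi> \<Longrightarrow> end_cone D \<M> \<A> S \<beta> E \<pi>"
  by (simp add: end_cone_def Ob_sub dual_eq ev_eq)

lemma (in tensor_subcategory) coend_cocone_restrict:
  assumes "coend_cocone C \<M> \<A> S \<beta> E \<pi>"
  shows "coend_cocone D \<M> \<A> S \<beta> E \<pi>"
  unfolding coend_cocone_def
proof (intro conjI ballI)
  show "dinatural_to \<M> \<A> S E \<pi>"
    using assms by (simp add: coend_cocone_def)
  fix X M assume X: "X \<in> Ob D" and M: "M \<in> Ob \<M>"
  then show "\<pi> M = \<pi> (dual D X \<rhd>\<^sub>o\<^bsub>\<M>\<^esub> M) \<bullet>\<^bsub>\<A>\<^esub> \<beta> X M (dual D X \<rhd>\<^sub>o\<^bsub>\<M>\<^esub> M)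
        \<bullet>\<^bsub>\<A>\<^esub> bmor S (ide \<M> M) (masc \<M> X (dual D X) M)
        \<bullet>\<^bsub>\<A>\<^esub> bmor S (ide \<M> M)
            ((coev D X \<rhd>\<^sub>m\<^bsub>\<M>\<^esub> ide \<M> M) \<bullet>\<^bsub>\<M>\<^esub> arrow_inv \<M> (unitob D \<rhd>\<^sub>o\<^bsub>\<M>\<^esub> M) M (munit \<M> M))"
    unfolding dual_eq[OF X] coev_eq[OF X] unitob_eq
    using assms Ob_sub unfolding coend_cocone_def by blast
qed

theorem proposition3p9:
  fixes K :: "('k, 'r) ring_scheme"
    and C :: "('o, 'm, 'k, 'z) tens_cat_scheme"
    and D :: "('o, 'm, 'k, 'w) tens_cat_scheme"
    and \<M> :: "('o, 'm, 'p, 'n, 'k, 'y) mod_cat_scheme"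
    and \<A> :: "('q, 'l, 'k, 'x) lin_cat_scheme"
    and S :: "('p, 'n, 'p, 'n, 'q, 'l) bifunctor"
    and \<beta> :: "'o \<Rightarrow> 'p \<Rightarrow> 'p \<Rightarrow> 'l"
  assumes "field K"
    and "tensor_category K C"
    and "tensor_subcategory K D C"
    and "module_category K C \<M>"
    and "finite_abelian_category K \<A>"
    and "linear_bifunctor K (op_cat \<M>) \<M> \<A> S"
    and "pre_balancing K C \<M> \<A> S \<beta>"
  shows "(\<forall>E \<pi> E\<^sub>D \<pi>\<^sub>D.
            is_module_end C \<M> \<A> S \<beta> E \<pi> \<longrightarrow> is_module_end D \<M> \<A> S \<beta> E\<^sub>D \<pi>\<^sub>D \<longrightarrow>
              (\<exists>\<iota>. is_monic \<A> E E\<^sub>D \<iota>)) \<and>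
         (\<forall>F \<rho> F\<^sub>D \<rho>\<^sub>D.
            is_module_coend C \<M> \<A> S \<beta> F \<rho> \<longrightarrow> is_module_coend D \<M> \<A> S \<beta> F\<^sub>D \<rho>\<^sub>D \<longrightarrow>
              (\<exists>p. is_epic \<A> F\<^sub>D F p))"
proof -
  interpret sub: tensor_subcategory K D C by fact
  interpret P: pre_balancing K C \<M> \<A> S \<beta> by fact
  have "\<exists>\<iota>. is_monic \<A> E E\<^sub>D \<iota>"
    if E: "is_module_end C \<M> \<A> S \<beta> E \<pi>" and E\<^sub>D: "is_module_end D \<M> \<A> S \<beta> E\<^sub>D \<pi>\<^sub>D"
    for E \<pi> E\<^sub>D \<pi>\<^sub>D
  proof -
    have "end_cone D \<M> \<A> S \<beta> E \<pi>"
      using E by (intro sub.end_cone_restrict) (simp add: is_module_end_def)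
    with E\<^sub>D obtain \<iota> where "\<iota> \<in> Hom \<A> E E\<^sub>D" "\<And>M. M \<in> Ob \<M> \<Longrightarrow> \<pi> M = \<pi>\<^sub>D M \<bullet>\<^bsub>\<A>\<^esub> \<iota>"
      unfolding is_module_end_def by blast
    moreover have "dinatural_from \<M> \<A> S E\<^sub>D \<pi>\<^sub>D"
      using E\<^sub>D by (simp add: is_module_end_def end_cone_def)
    ultimately show ?thesis
      using P.module_end_factor_monic[OF E] by blast
  qed
  moreover have "\<exists>p. is_epic \<A> F\<^sub>D F p"
    if F: "is_module_coend C \<M> \<A> S \<beta> F \<rho>" and F\<^sub>D: "is_module_coend D \<M> \<A> S \<beta> F\<^sub>D \<rho>\<^sub>D"
    for F \<rho> F\<^sub>D \<rho>\<^sub>D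
  proof -
    have "coend_cocone D \<M> \<A> S \<beta> F \<rho>"
      using F by (intro sub.coend_cocone_restrict) (simp add: is_module_coend_def)
    with F\<^sub>D obtain p where "p \<in> Hom \<A> F\<^sub>D F" "\<And>M. M \<in> Ob \<M> \<Longrightarrow> \<rho> M = p \<bullet>\<^bsub>\<A>\<^esub> \<rho>\<^sub>D M"
      unfolding is_module_coend_def by blast
    moreover have "dinatural_to \<M> \<A> S F\<^sub>D \<rho>\<^sub>D"
      using F\<^sub>D by (simp add: is_module_coend_def coend_cocone_def)
    ultimately show ?thesis
      using P.module_coend_factor_epic[OF F] by blast
  qed
  ultimately show ?thesis by blast
qed

end
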